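(* Assume the settings (H0) and (H1) described in the context, and that $f$ admits (continuous) partial derivatives of any order with respect to $x$ which are bounded along $(X^s(\tau),\Lambda(\tau))$ and $(X^u(\tau),\Lambda(\tau))$, $\tau\in\mathbb{R}$. Let $C_n^s,C_n^u,\overline r_n^s,\overline r_n^u>0$ and $S_n^s,S_n^u$ be as in the context, and fix $n\in\mathbb{N}$ and $0<r<\overline r_n:=\min\{\overline r_n^s,\overline r_n^u\}$. If there are $\varepsilon>0$ and $T>0$ such that, for all $t>T$, \[ X^u_++\varepsilon<S_n^s(r,t)-C_n^sr^{n+1},\quad\text{or}\quad S_n^u(r,-t)+C_n^ur^{n+1}<X^s_--\varepsilon, \] then $x^r_-$ and $x^r_+$ are distinct. In particular, if the future limit-problem $\dot x=f_+(x)$ does not have any other unstable equilibria, or if for any other hyperbolic unstable equilibrium $Y^u_+>X^s_+$ of $\dot x=f_+(x)$ one has that \[ S_n^s(r,t)+C_n^sr^{n+1}<Y^u_+-\varepsilon\quad\text{for all }t>T, \] then $x^r_-$ end-point tracks the associated curve of quasi-static equilibria.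
   Context: Here $\mathbb{N}=\{0,1,2,\dots\}$. Setting (H0). Let $\lambda_-<\lambda_+$ be real numbers and let $f\in C^2(\mathbb{R}\times\mathbb{R},\mathbb{R})$, $(x,\lambda)\mapsto f(x,\lambda)$, be bounded and such that the autonomous scalar problems $\dot x=f(x,\lambda)$, $\lambda\in[\lambda_-,\lambda_+]$, have existence and uniqueness of solutions and continuous dependence on parameter and initial data. A fixed point $X$ of $\dot x=f(x,\lambda)$ is hyperbolic if $\partial_xf(X,\lambda)\ne0$; it is then stable if $\partial_xf(X,\lambda)<0$ and unstable if $\partial_xf(X,\lambda)>0$. For every $\lambda\in[\lambda_-,\lambda_+]$, except at most a finite number of points in $(\lambda_-,\lambda_+)$, $\dot x=f(x,\lambda)$ has only hyperbolic fixed points. There is a stable hyperbolic fixed point $X^s_-$ of $\dot x=f(x,\lambda_-)$ which is continuously perturbed into stable hyperbolic fixed points, i.e. there is a continuous function $X^s:[\lambda_-,\lambda_+]\to\mathbb{R}$ with $X^s(\lambda_-)=X^s_-$ such that $X^s(\lambda)$ is a stable hyperbolic fixed point of $\dot x=f(x,\lambda)$ for all $\lambda\in[\lambda_-,\lambda_+]$. Write $X^s_+:=X^s(\lambda_+)$. Let $\Lambda\in C^2(\mathbb{R},[\lambda_-,\lambda_+])$ be strictly increasing with $\lim_{t\to\pm\infty}\Lambda(t)=\lambda_\pm$ and $\lim_{t\to\pm\infty}\Lambda'(t)=0$. For $r>0$ consider \[ \dot x=f\big(x,\Lambda(rt)\big),\qquad x\in\mathbb{R},\ t\in\mathbb{R}.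 \qquad (E_r) \] The future limit-problem is $\dot x=f_+(x):=f(x,\lambda_+)$. With an abuse of notation $X^s(t):=X^s(\Lambda(t))$. There is $p>0$ such that $\partial_xf(X^s(t),\Lambda(t))<-p<0$ for all $t\in\mathbb{R}$. Assumption (H1). The problem $\dot x=f(x,\lambda_+)$ has an unstable hyperbolic fixed point $X^u_+$ which is continuously perturbed into a hyperbolic fixed point $X^u(\lambda)$ of $\dot x=f(x,\lambda)$ for all $\lambda\in[\lambda_-,\lambda_+]$ (so $X^u:[\lambda_-,\lambda_+]\to\mathbb{R}$ is continuous, $X^u(\lambda_+)=X^u_+$); by abuse of notation, $X^u(t):=X^u(\Lambda(t))$. For all $\lambda\in[\lambda_-,\lambda_+]$ there are no further fixed points in the open interval with end-points $X^u(\lambda)$ and $X^s(\lambda)$. There is $d_0>0$ such that for any two distinct curves of quasi-static equilibria (continuous $X,Y:[\lambda_-,\lambda_+]\to\mathbb{R}$ of equilibria) one has $\min_{\lambda\in[\lambda_-,\lambda_+]}|X(\lambda)-Y(\lambda)|>d_0$. It is assumed that $X^s(\lambda)>X^u(\lambda)$ for all $\lambda$. Pullback solutions. For every $r>0$, $x^r_-:(-\infty,\beta^r_-)\to\mathbb{R}$ denotes the unique solution of $(E_r)$ with $\lim_{t\to-\infty}x^r_-(t)=X^s_-$, and $x^r_+:(\beta^r_+,\infty)\to\mathbb{R}$ denotes the unique solution of $(E_r)$ with $\lim_{t\to\infty}x^r_+(t)=X^u_+$ (both exist and are unique). $x^r_-$ end-point tracks the curve of quasi-static equilibria $X^s$ if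 it is defined on all of $\mathbb{R}$ and $\lim_{t\to+\infty}x^r_-(t)=X^s_+$. Series approximations. $S_n^s(r,t)=\sum_{i=0}^na_i^s(rt)r^i$ and $S_n^u(r,t)=\sum_{i=0}^na_i^u(rt)r^i$, where $(a^s_i)$ (resp. $(a^u_i)$) are the bounded continuous coefficients of the formal series solution $\sum_ia_i(\tau)r^i$ of $r\frac{dx}{d\tau}=f(x,\Lambda(\tau))$ with $a_0=X^s$ (resp. $a_0=X^u$): $a_1(\tau)=(\partial_xf)^{-1}\dot a_0(\tau)$ and, for $i\ge2$, \[ a_i(\tau)=\big(\partial_xf\big)^{-1}\Big[\dot a_{i-1}(\tau)-\sum_{j=2}^i\frac1{j!}\frac{\partial^jf}{\partial x^j}\sum_{\substack{k_1+\dots+k_j=i\\ k_l\ge1}}a_{k_1}(\tau)\cdots a_{k_j}(\tau)\Big], \] all derivatives of $f$ being evaluated at $(a_0(\tau),\Lambda(\tau))$. The constants $C_n^s,\overline r_n^s,C_n^u,\overline r_n^u>0$ are such that for every $n\in\mathbb{N}$: if $0<r<\overline r_n^s$, then $x^r_-$ is defined on $\mathbb{R}$ and $\sup_{t\in\mathbb{R}}|S_n^s(r,t)-x^r_-(t)|<C_n^sr^{n+1}$; if $0<r<\overline r_n^u$, then $x^r_+$ is defined on $\mathbb{R}$ and $\sup_{t\in\mathbb{R}}|S_n^u(r,t)-x^r_+(t)|<C_n^ur^{n+1}$. *)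

theory Defs
  imports "HOL-Analysis.Analysis"
begin

text \<open>
  Right-hand sides are curried as \<open>f x \<mu>\<close> (state, then parameter); the parameter interval
  is \<open>{lm..lp}\<close>.
\<close>

definition C2 :: "('a::real_normed_vector \<Rightarrow> 'b::real_normed_vector) \<Rightarrow> bool" where
  "C2 F \<longleftrightarrow>
     (\<exists>F' :: 'a \<Rightarrow> 'a \<Rightarrow>\<^sub>L 'b. \<exists>F'' :: 'a \<Rightarrow> 'a \<Rightarrow>\<^sub>L 'a \<Rightarrow>\<^sub>L 'b.
        (\<forall>z. (F has_derivative blinfun_apply (F' z)) (at z)) \<and>
        (\<forall>z. (F' has_derivative blinfun_apply (F'' z)) (at z)) \<and>
        continuous_on UNIV F'')"

definition partial_x :: "nat \<Rightarrow> (real \<Rightarrow> real \<Rightarrow> real) \<Rightarrow> real \<Rightarrow> real \<Rightarrow> real" where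
  "partial_x j f x \<mu> = (deriv ^^ j) (\<lambda>y. f y \<mu>) x"

definition x_smooth :: "(real \<Rightarrow> real \<Rightarrow> real) \<Rightarrow> bool" where
  "x_smooth f \<longleftrightarrow>
     (\<forall>j. (\<forall>x \<mu>. (\<lambda>y. partial_x j f y \<mu>) field_differentiable at x) \<and>
          continuous_on UNIV (\<lambda>(x, \<mu>). partial_x j f x \<mu>))"


subsection \<open>Equilibria and solutions\<close>

definition fixed_point :: "(real \<Rightarrow> real \<Rightarrow> real) \<Rightarrow> real \<Rightarrow> real \<Rightarrow> bool" where
  "fixed_point f \<mu> X \<longleftrightarrow> f X \<mu> = 0"

definition hyperbolic :: "(real \<Rightarrow> real \<Rightarrow> real) \<Rightarrow> real \<Rightarrow> real \<Rightarrow> bool" where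
  "hyperbolic f \<mu> X \<longleftrightarrow> fixed_point f \<mu> X \<and> partial_x 1 f X \<mu> \<noteq> 0"

definition stable_hyperbolic :: "(real \<Rightarrow> real \<Rightarrow> real) \<Rightarrow> real \<Rightarrow> real \<Rightarrow> bool" where
  "stable_hyperbolic f \<mu> X \<longleftrightarrow> hyperbolic f \<mu> X \<and> partial_x 1 f X \<mu> < 0"

definition unstable_hyperbolic :: "(real \<Rightarrow> real \<Rightarrow> real) \<Rightarrow> real \<Rightarrow> real \<Rightarrow> bool" where
  "unstable_hyperbolic f \<mu> X \<longleftrightarrow> hyperbolic f \<mu> X \<and> partial_x 1 f X \<mu> > 0"

definition quasi_static_curve ::
    "(real \<Rightarrow> real \<Rightarrow> real) \<Rightarrow> real \<Rightarrow> real \<Rightarrow> (real \<Rightarrow> real) \<Rightarrow> bool" where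
  "quasi_static_curve f lm lp X \<longleftrightarrow>
     continuous_on {lm..lp} X \<and> (\<forall>\<mu>\<in>{lm..lp}. fixed_point f \<mu> (X \<mu>))"

definition solves :: "(real \<Rightarrow> real \<Rightarrow> real) \<Rightarrow> real set \<Rightarrow> (real \<Rightarrow> real) \<Rightarrow> bool" where
  "solves g I x \<longleftrightarrow> (\<forall>t\<in>I. (x has_real_derivative g t (x t)) (at t within I))"

text \<open>
  Existence, uniqueness and continuous dependence for the autonomous problems, by means of the
  flow \<open>\<phi> t x \<mu>\<close>. It is global in time, as \<open>f\<close> is bounded wherever this is used.
\<close>

definition well_posed :: "(real \<Rightarrow> real \<Rightarrow> real) \<Rightarrow> real \<Rightarrow> real \<Rightarrow> bool" where
  "well_posed f lm lp \<longleftrightarrow>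
     (\<exists>\<phi> :: real \<Rightarrow> real \<Rightarrow> real \<Rightarrow> real.
        (\<forall>\<mu>\<in>{lm..lp}. \<forall>x.
           \<phi> 0 x \<mu> = x \<and>
           solves (\<lambda>t z. f z \<mu>) UNIV (\<lambda>t. \<phi> t x \<mu>) \<and>
           (\<forall>I y. open I \<and> connected I \<and> 0 \<in> I \<and> y 0 = x \<and> solves (\<lambda>t z. f z \<mu>) I y
              \<longrightarrow> (\<forall>t\<in>I. y t = \<phi> t x \<mu>))) \<and>
        continuous_on (UNIV \<times> UNIV \<times> {lm..lp}) (\<lambda>(t, x, \<mu>). \<phi> t x \<mu>))"


subsection \<open>The standing assumptions\<close>

text \<open>The limit equilibria are \<open>Xs lm\<close>, \<open>Xs lp\<close> and \<open>Xu lp\<close>.\<close>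

locale setting_H0 =
  fixes f :: "real \<Rightarrow> real \<Rightarrow> real" and lm lp :: real and \<Lambda> Xs :: "real \<Rightarrow> real"
  assumes lm_less_lp: "lm < lp"
    and f_C2: "C2 (\<lambda>(x, \<mu>). f x \<mu>)"
    and f_bounded: "bounded (range (\<lambda>(x, \<mu>). f x \<mu>))"
    and f_well_posed: "well_posed f lm lp"
    and finite_nonhyperbolic:
      "\<exists>E. finite E \<and> E \<subseteq> {lm<..<lp} \<and>
         (\<forall>\<mu>\<in>{lm..lp} - E. \<forall>X. fixed_point f \<mu> X \<longrightarrow> hyperbolic f \<mu> X)"
    and Xs_continuous: "continuous_on {lm..lp} Xs"
    and Xs_stable: "\<forall>\<mu>\<in>{lm..lp}. stable_hyperbolic f \<mu> (Xs \<mu>)"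
    and Lambda_C2: "C2 \<Lambda>"
    and Lambda_range: "\<forall>t. \<Lambda> t \<in> {lm..lp}"
    and Lambda_strict_mono: "strict_mono \<Lambda>"
    and Lambda_at_bot: "(\<Lambda> \<longlongrightarrow> lm) at_bot"
    and Lambda_at_top: "(\<Lambda> \<longlongrightarrow> lp) at_top"
    and deriv_Lambda_at_bot: "(deriv \<Lambda> \<longlongrightarrow> 0) at_bot"
    and deriv_Lambda_at_top: "(deriv \<Lambda> \<longlongrightarrow> 0) at_top"
    and Xs_uniformly_stable: "\<exists>p>0. \<forall>t. partial_x 1 f (Xs (\<Lambda> t)) (\<Lambda> t) < - p"

text \<open>
  In \<open>curves_separated\<close> the minimum of \<open>\<bar>X - Y\<bar>\<close> over the compact interval is attained, so that
  it exceeds \<open>d\<close> iff all values do.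
\<close>

locale setting_H1 = setting_H0 +
  fixes Xu :: "real \<Rightarrow> real"
  assumes Xu_continuous: "continuous_on {lm..lp} Xu"
    and Xu_hyperbolic: "\<forall>\<mu>\<in>{lm..lp}. hyperbolic f \<mu> (Xu \<mu>)"
    and Xu_unstable: "unstable_hyperbolic f lp (Xu lp)"
    and none_between:
      "\<forall>\<mu>\<in>{lm..lp}. \<forall>x\<in>open_segment (Xu \<mu>) (Xs \<mu>). \<not> fixed_point f \<mu> x"
    and curves_separated:
      "\<exists>d>0. \<forall>X Y. quasi_static_curve f lm lp X \<and> quasi_static_curve f lm lp Y \<and>
         (\<exists>\<mu>\<in>{lm..lp}. X \<mu> \<noteq> Y \<mu>) \<longrightarrow> (\<forall>\<mu>\<in>{lm..lp}. \<bar>X \<mu> - Y \<mu>\<bar> > d)"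
    and Xu_less_Xs: "\<forall>\<mu>\<in>{lm..lp}. Xu \<mu> < Xs \<mu>"


subsection \<open>Pullback solutions and end-point tracking\<close>

text \<open>
  A solution on a half-line is a total function together with the finite or infinite end-point
  of its interval of definition; its values outside that interval carry no meaning.
\<close>

definition past_solution ::
    "(real \<Rightarrow> real \<Rightarrow> real) \<Rightarrow> (real \<Rightarrow> real) \<Rightarrow> real \<Rightarrow> real \<Rightarrow> ereal \<Rightarrow> (real \<Rightarrow> real) \<Rightarrow> bool" where
  "past_solution f \<Lambda> r X \<beta> x \<longleftrightarrow>
     - \<infinity> < \<beta> \<and> solves (\<lambda>t z. f z (\<Lambda> (r * t))) {t. ereal t < \<beta>} x \<and> (x \<longlongrightarrow> X) at_bot"

definition future_solution ::
    "(real \<Rightarrow> real \<Rightarrow> real) \<Rightarrow> (real \<Rightarrow> real) \<Rightarrow> real \<Rightarrow> real \<Rightarrow> ereal \<Rightarrow> (real \<Rightarrow> real) \<Rightarrow> bool" where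
  "future_solution f \<Lambda> r X \<beta> x \<longleftrightarrow>
     \<beta> < \<infinity> \<and> solves (\<lambda>t z. f z (\<Lambda> (r * t))) {t. \<beta> < ereal t} x \<and> (x \<longlongrightarrow> X) at_top"

text \<open>
  ``The unique solution'' is the unique maximal one: every other solution with the same limit
  is a restriction of it.
\<close>

definition unique_past_solution ::
    "(real \<Rightarrow> real \<Rightarrow> real) \<Rightarrow> (real \<Rightarrow> real) \<Rightarrow> real \<Rightarrow> real \<Rightarrow> ereal \<Rightarrow> (real \<Rightarrow> real) \<Rightarrow> bool" where
  "unique_past_solution f \<Lambda> r X \<beta> x \<longleftrightarrow>
     past_solution f \<Lambda> r X \<beta> x \<and>
     (\<forall>\<beta>' y. past_solution f \<Lambda> r X \<beta>' y
        \<longrightarrow> \<beta>' \<le> \<beta> \<and> (\<forall>t. ereal t < \<beta>' \<longrightarrow> y t = x t))"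

definition unique_future_solution ::
    "(real \<Rightarrow> real \<Rightarrow> real) \<Rightarrow> (real \<Rightarrow> real) \<Rightarrow> real \<Rightarrow> real \<Rightarrow> ereal \<Rightarrow> (real \<Rightarrow> real) \<Rightarrow> bool" where
  "unique_future_solution f \<Lambda> r X \<beta> x \<longleftrightarrow>
     future_solution f \<Lambda> r X \<beta> x \<and>
     (\<forall>\<beta>' y. future_solution f \<Lambda> r X \<beta>' y
        \<longrightarrow> \<beta> \<le> \<beta>' \<and> (\<forall>t. \<beta>' < ereal t \<longrightarrow> y t = x t))"

definition end_point_tracks :: "ereal \<Rightarrow> (real \<Rightarrow> real) \<Rightarrow> real \<Rightarrow> bool" where
  "end_point_tracks \<beta> x Xp \<longleftrightarrow> \<beta> = \<infinity> \<and> (x \<longlongrightarrow> Xp) at_top"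


subsection \<open>The formal series\<close>

definition compositions :: "nat \<Rightarrow> nat \<Rightarrow> nat list set" where
  "compositions j i = {ks. length ks = j \<and> sum_list ks = i \<and> (\<forall>k\<in>set ks. 1 \<le> k)}"

lemma compositions_less:
  assumes "ks \<in> compositions j i" "2 \<le> j" "k \<in> set ks"
  shows "k < i"
proof -
  obtain us vs where ks: "ks = us @ k # vs"
    using assms(3) by (meson split_list)
  have "length us + length vs \<ge> 1"
    using assms(1,2) ks by (simp add: compositions_def)
  then obtain m where m: "m \<in> set (us @ vs)"
    by (cases us; cases vs) auto
  have "1 \<le> m" "m \<le> sum_list (us @ vs)"
    using assms(1) ks m member_le_sum_list[OF m] by (auto simp: compositions_def)
  then show ?thesis
    using assms(1) ks by (simp add: compositions_def)
qed

text \<open>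
  The formula for \<open>i \<ge> 2\<close> covers \<open>i = 1\<close> as well: the sum over \<open>j\<close> is then empty.
\<close>

function series_coeff ::
    "(real \<Rightarrow> real \<Rightarrow> real) \<Rightarrow> (real \<Rightarrow> real) \<Rightarrow> (real \<Rightarrow> real) \<Rightarrow> nat \<Rightarrow> real \<Rightarrow> real" where
  "series_coeff f \<Lambda> X 0 = (\<lambda>\<tau>. X (\<Lambda> \<tau>))"
| "series_coeff f \<Lambda> X (Suc i) = (\<lambda>\<tau>.
     inverse (partial_x 1 f (X (\<Lambda> \<tau>)) (\<Lambda> \<tau>)) *
     (deriv (series_coeff f \<Lambda> X i) \<tau> -
      (\<Sum>j\<in>{2..Suc i}. 1 / fact j * partial_x j f (X (\<Lambda> \<tau>)) (\<Lambda> \<tau>) *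
         (\<Sum>ks\<in>compositions j (Suc i). prod_list (map (\<lambda>k. series_coeff f \<Lambda> X k \<tau>) ks)))))"
  by pat_completeness auto
termination
  by (relation "Wellfounded.measure (\<lambda>(f, \<Lambda>, X, i). i)") (auto dest: compositions_less)

definition series_approx ::
    "(real \<Rightarrow> real \<Rightarrow> real) \<Rightarrow> (real \<Rightarrow> real) \<Rightarrow> (real \<Rightarrow> real) \<Rightarrow> nat \<Rightarrow> real \<Rightarrow> real \<Rightarrow> real" where
  "series_approx f \<Lambda> X n r t = (\<Sum>i\<le>n. series_coeff f \<Lambda> X i (r * t) * r ^ i)"

text \<open>
  Differentiability of the coefficients is what makes the recursion, which contains
  \<open>deriv\<close>, meaningful.
\<close>

definition bounded_formal_series ::
    "(real \<Rightarrow> real \<Rightarrow> real) \<Rightarrow> (real \<Rightarrow> real) \<Rightarrow> (real \<Rightarrow> real) \<Rightarrow> bool" where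
  "bounded_formal_series f \<Lambda> X \<longleftrightarrow>
     (\<forall>i. (\<forall>\<tau>. series_coeff f \<Lambda> X i field_differentiable at \<tau>) \<and>
          continuous_on UNIV (series_coeff f \<Lambda> X i) \<and>
          bounded (range (series_coeff f \<Lambda> X i)))"

text \<open>
  The supremum is taken in the extended reals, where it is \<open>\<infinity>\<close> for unbounded differences.
\<close>

definition sup_dist :: "(real \<Rightarrow> real) \<Rightarrow> (real \<Rightarrow> real) \<Rightarrow> ereal" where
  "sup_dist x y = (SUP t. ereal \<bar>x t - y t\<bar>)"

end

theory Submission
  imports Defs
begin

text \<open>
  If the two pullback solutions coincided, one solution would tend to \<open>Xs lm\<close> in the past and
  to \<open>Xu lp\<close> in the future; evaluating the error estimates at \<open>t\<close> and \<open>- t\<close> for a large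
  \<open>t\<close> contradicts whichever alternative of the separation holds at that \<open>t\<close>.

  For the tracking, the error estimate makes \<open>xm r\<close> bounded, because the series coefficients
  are. The limit equation has only isolated equilibria, and a solution of an asymptotically
  autonomous scalar equation can eventually cross a level that is not an equilibrium of the limit
  equation in one direction only. Hence \<open>xm r\<close> converges to some equilibrium \<open>Y\<close> of the
  limit equation (\<open>bounded_asymptotically_autonomous_converges\<close>,
  \<open>asymptotically_autonomous_limit_is_zero\<close>), and it remains to show \<open>Y = Xs lp\<close>.

  From below: \<open>Y \<noteq> Xu lp\<close>, since otherwise \<open>xm r\<close> would be the unique solution
  \<open>xp r\<close>. If the first alternative of the separation holds for all large \<open>t\<close>, then
  \<open>Y > Xu lp\<close> at once. If not, the second one holds at arbitrarily large \<open>t\<close>, so that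
  \<open>xp r < xm r\<close> at some time in the far past; as the two solutions never meet
  (\<open>pullback_solutions_never_meet\<close>), this order persists and again \<open>Y > Xu lp\<close>. Since
  there is no equilibrium between \<open>Xu lp\<close> and \<open>Xs lp\<close>, it follows that
  \<open>Y \<ge> Xs lp\<close>.

  From above: if \<open>Y > Xs lp\<close>, the first equilibrium above the stable point \<open>Xs lp\<close> is
  unstable and at most \<open>Y\<close> (\<open>unstable_zero_above_stable_zero\<close>). Either there is no such
  equilibrium, or the upper estimate keeps \<open>xm r\<close> at distance at least \<open>\<epsilon>\<close> below it,
  and it cannot converge to \<open>Y\<close>.
\<close>


section \<open>Asymptotically autonomous scalar equations\<close>

text \<open>
  A level through which the solution can only pass upwards is a barrier from below: at the first
  return to the level from above the derivative would have to be nonpositive.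
\<close>

lemma stays_above_level:
  fixes x x' :: "real \<Rightarrow> real"
  assumes deriv: "\<And>t. (x has_real_derivative x' t) (at t)"
    and up: "\<And>t. t1 \<le> t \<Longrightarrow> x t = c \<Longrightarrow> 0 < x' t"
    and start: "c \<le> x t1" and "t1 < t2"
  shows "c < x t2"
proof (rule ccontr)
  assume "\<not> c < x t2"
  then have low: "x t2 \<le> c" by simp
  have cont: "continuous_on A x" for A
    by (meson DERIV_isCont continuous_at_imp_continuous_on deriv)
  (* The first return is sought after a time at which x is strictly above the level, so that
     x = c at the start does not count as a return. *)
  obtain u where u: "t1 \<le> u" "u < t2" "c < x u"
  proof (cases "c < x t1")
    case True
    then show ?thesis using that[of t1] \<open>t1 < t2\<close> by simp
  next
    case False
    with start have eq: "x t1 = c" by simp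
    with up have "0 < x' t1" by simp
    from DERIV_pos_inc_right[OF deriv this] obtain d
      where d: "d > 0" "\<And>h. 0 < h \<Longrightarrow> h < d \<Longrightarrow> x t1 < x (t1 + h)" by blast
    show ?thesis
      using that[of "t1 + min (d/2) ((t2 - t1)/2)"] d(1) d(2)[of "min (d/2) ((t2 - t1)/2)"]
        \<open>t1 < t2\<close> eq by (auto simp: min_def field_simps split: if_splits)
  qed
  define K where "K = {u..t2} \<inter> x -` {c}"
  have "compact K"
    unfolding K_def
    by (intro compact_Int_closed closed_vimage compact_Icc closed_singleton)
       (simp add: cont)
  moreover have "K \<noteq> {}"
    using IVT2'[of x t2 c u] u low cont unfolding K_def by force
  ultimately obtain s where s: "s \<in> K" and first: "\<And>t. t \<in> K \<Longrightarrow> s \<le> t"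
    using compact_attains_inf[of K] by metis
  have sK: "u \<le> s" "s \<le> t2" "x s = c" using s by (auto simp: K_def)
  have "u < s" using u(3) sK by (cases "u = s") auto
  have "0 < x' s" using up sK u(1) by simp
  from DERIV_pos_inc_left[OF deriv this] obtain d
    where d: "d > 0" "\<And>h. 0 < h \<Longrightarrow> h < d \<Longrightarrow> x (s - h) < x s" by blast
  define v where "v = s - min (d/2) ((s - u)/2)"
  have v: "u < v" "v < s" "x v < c"
    using d(1) d(2)[of "s - v"] \<open>u < s\<close> sK(3) by (auto simp: v_def min_def field_simps)
  obtain w where "u \<le> w" "w \<le> v" "x w = c"
    using IVT2'[of x v c u] v u(3) cont by force
  then have "w \<in> K" using v(2) sK(2) by (simp add: K_def)
  with first[of w] \<open>w \<le> v\<close> v(2) show False by simp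
qed

text \<open>
  Near the level the sign of the limit field is eventually inherited, so all late crossings go the
  same way.
\<close>

lemma eventually_on_one_side_if_pos:
  fixes f :: "real \<Rightarrow> real \<Rightarrow> real" and \<mu> x :: "real \<Rightarrow> real"
  assumes cont: "continuous_on UNIV (\<lambda>(y, m). f y m)"
    and \<mu>: "(\<mu> \<longlongrightarrow> m) at_top"
    and deriv: "\<And>t. (x has_real_derivative f (x t) (\<mu> t)) (at t)"
    and pos: "0 < f c m"
  shows "(\<forall>\<^sub>F t in at_top. x t < c) \<or> (\<forall>\<^sub>F t in at_top. c < x t)"
proof -
  have "((\<lambda>t. f c (\<mu> t)) \<longlongrightarrow> f c m) at_top"
    using continuous_on_tendsto_compose[OF cont tendsto_Pair[OF tendsto_const \<mu>], of c] by simp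
  then have "\<forall>\<^sub>F t in at_top. 0 < f c (\<mu> t)"
    by (rule order_tendstoD(1)) (rule pos)
  then obtain t0 where t0: "\<And>t. t0 \<le> t \<Longrightarrow> 0 < f c (\<mu> t)"
    by (auto simp: eventually_at_top_linorder)
  show ?thesis
  proof (cases "\<forall>t\<ge>t0. x t < c")
    case True
    then show ?thesis by (auto simp: eventually_at_top_linorder)
  next
    case False
    then obtain t1 where t1: "t0 \<le> t1" "c \<le> x t1" by force
    have "c < x t" if "t1 < t" for t
      by (rule stays_above_level[OF deriv _ t1(2) that]) (use t0 t1(1) in auto)
    then show ?thesis by (auto simp: eventually_at_top_dense)
  qed
qed

lemma eventually_on_one_side:
  fixes f :: "real \<Rightarrow> real \<Rightarrow> real" and \<mu> x :: "real \<Rightarrow> real"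
  assumes cont: "continuous_on UNIV (\<lambda>(y, m). f y m)"
    and \<mu>: "(\<mu> \<longlongrightarrow> m) at_top"
    and deriv: "\<And>t. (x has_real_derivative f (x t) (\<mu> t)) (at t)"
    and nonzero: "f c m \<noteq> 0"
  shows "(\<forall>\<^sub>F t in at_top. x t < c) \<or> (\<forall>\<^sub>F t in at_top. c < x t)"
proof (cases "0 < f c m")
  case True
  then show ?thesis by (rule eventually_on_one_side_if_pos[OF cont \<mu> deriv])
next
  case False
  (* Reflecting the state space turns a downward crossing into an upward one. *)
  let ?g = "\<lambda>y m. - f (- y) m"
  have "continuous_on UNIV (\<lambda>p. - (case (- fst p, snd p) of (y, m) \<Rightarrow> f y m))"
    by (intro continuous_on_minus continuous_on_compose2[OF cont] continuous_intros subset_UNIV)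
  then have "continuous_on UNIV (\<lambda>(y, m). ?g y m)"
    by (simp add: case_prod_unfold)
  moreover have "((\<lambda>t. - x t) has_real_derivative ?g (- x t) (\<mu> t)) (at t)" for t
    using DERIV_minus[OF deriv] by simp
  moreover have "0 < ?g (- c) m" using False nonzero by simp
  ultimately have "(\<forall>\<^sub>F t in at_top. - x t < - c) \<or> (\<forall>\<^sub>F t in at_top. - c < - x t)"
    by (rule eventually_on_one_side_if_pos[OF _ \<mu>])
  then show ?thesis by auto
qed

text \<open>
  The limit is the supremum of the levels that the solution eventually exceeds. A level just above
  it that is not a zero of the limit field is not exceeded eventually, hence is eventually an upper
  bound.
\<close>

lemma bounded_asymptotically_autonomous_converges:
  fixes f :: "real \<Rightarrow> real \<Rightarrow> real" and \<mu> x :: "real \<Rightarrow> real"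
  assumes cont: "continuous_on UNIV (\<lambda>(y, m). f y m)"
    and \<mu>: "(\<mu> \<longlongrightarrow> m) at_top"
    and deriv: "\<And>t. (x has_real_derivative f (x t) (\<mu> t)) (at t)"
    and bounded: "\<And>t. \<bar>x t\<bar> \<le> B"
    and nonzero_dense: "\<And>a b. a < b \<Longrightarrow> \<exists>c. a < c \<and> c < b \<and> f c m \<noteq> 0"
  shows "\<exists>Y. (x \<longlongrightarrow> Y) at_top"
proof
  define A where "A = {c. \<forall>\<^sub>F t in at_top. c < x t}"
  have "- B - 1 < x t" for t using bounded[of t] by simp
  then have "- B - 1 \<in> A" by (simp add: A_def)
  then have ne: "A \<noteq> {}" by blast
  have "c \<le> B" if "c \<in> A" for c
  proof -
    from that obtain t where "c < x t"
      by (auto simp: A_def eventually_at_top_linorder)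
    with bounded[of t] show ?thesis by simp
  qed
  then have bdd: "bdd_above A" by (auto simp: bdd_above_def)
  show "(x \<longlongrightarrow> Sup A) at_top"
  proof (rule order_tendstoI)
    fix a assume "a < Sup A"
    then obtain c where "c \<in> A" "a < c" using less_cSup_iff[OF ne bdd] by blast
    then show "\<forall>\<^sub>F t in at_top. a < x t"
      unfolding A_def by (auto elim: eventually_mono)
  next
    fix b assume "Sup A < b"
    then obtain c where c: "Sup A < c" "c < b" "f c m \<noteq> 0" using nonzero_dense by blast
    then have "c \<notin> A" using cSup_upper[OF _ bdd, of c] by auto
    with eventually_on_one_side[OF cont \<mu> deriv c(3)] have "\<forall>\<^sub>F t in at_top. x t < c"
      by (simp add: A_def)
    then show "\<forall>\<^sub>F t in at_top. x t < b"
      using c(2) by (auto elim: eventually_mono)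
  qed
qed

text \<open>
  The derivative converges to the value of the limit field at the limit, while the increments over
  unit time intervals tend to zero.
\<close>

lemma asymptotically_autonomous_limit_is_zero:
  fixes f :: "real \<Rightarrow> real \<Rightarrow> real" and \<mu> x :: "real \<Rightarrow> real"
  assumes cont: "continuous_on UNIV (\<lambda>(y, m). f y m)"
    and \<mu>: "(\<mu> \<longlongrightarrow> m) at_top"
    and deriv: "\<And>t. (x has_real_derivative f (x t) (\<mu> t)) (at t)"
    and lim: "(x \<longlongrightarrow> Y) at_top"
  shows "f Y m = 0"
proof -
  have "\<exists>s>t. x (t + 1) - x t = f (x s) (\<mu> s)" for t
    using MVT2[of t "t + 1" x "\<lambda>s. f (x s) (\<mu> s)"] deriv by auto
  then obtain \<sigma> where \<sigma>: "\<And>t. t < \<sigma> t" "\<And>t. x (t + 1) - x t = f (x (\<sigma> t)) (\<mu> (\<sigma> t))"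
    by metis
  have \<sigma>_top: "filterlim \<sigma> at_top at_top"
    by (rule filterlim_at_top_mono[OF filterlim_ident])
       (simp add: \<sigma>(1) less_imp_le)
  have field: "((\<lambda>t. f (x t) (\<mu> t)) \<longlongrightarrow> f Y m) at_top"
    using continuous_on_tendsto_compose[OF cont tendsto_Pair[OF lim \<mu>]] by simp
  have "((\<lambda>t. x (t + 1) - x t) \<longlongrightarrow> f Y m) at_top"
    unfolding \<sigma>(2) by (rule filterlim_compose[OF field \<sigma>_top])
  moreover have "filterlim (\<lambda>t::real. t + 1) at_top at_top"
    by (rule filterlim_at_top_mono[OF filterlim_ident]) simp
  then have "((\<lambda>t. x (t + 1) - x t) \<longlongrightarrow> Y - Y) at_top"
    by (intro tendsto_diff filterlim_compose[OF lim] lim)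
  ultimately show ?thesis using tendsto_unique[OF trivial_limit_at_top_linorder] by fastforce
qed


section \<open>Zeros of scalar fields\<close>

lemma nonzero_between_if_simple_zeros:
  fixes h :: "real \<Rightarrow> real"
  assumes simple: "\<And>y. h y = 0 \<Longrightarrow> deriv h y \<noteq> 0" and "a < b"
  shows "\<exists>c. a < c \<and> c < b \<and> h c \<noteq> 0"
proof (rule ccontr)
  assume "\<not> ?thesis"
  then have zero: "h c = 0" if "a < c" "c < b" for c using that by blast
  define c where "c = (a + b) / 2"
  have c: "a < c" "c < b" using \<open>a < b\<close> by (auto simp: c_def)
  have "(h has_real_derivative 0) (at c)"
    by (rule has_field_derivative_transform_within_open[of "\<lambda>_. 0" 0 c "{a<..<b}"])
       (use c zero in auto)
  then have "deriv h c = 0" by (rule DERIV_imp_deriv)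
  with simple[of c] zero[OF c] show False by simp
qed

text \<open>
  Just above a stable zero the field is negative, and it stays negative up to the next zero, where
  its derivative therefore cannot be negative.
\<close>

lemma unstable_zero_above_stable_zero:
  fixes h :: "real \<Rightarrow> real"
  assumes diff: "\<And>y. (h has_real_derivative deriv h y) (at y)"
    and simple: "\<And>y. h y = 0 \<Longrightarrow> deriv h y \<noteq> 0"
    and stable: "h X = 0" "deriv h X < 0"
    and above: "h Y = 0" "X < Y"
  shows "\<exists>Z. X < Z \<and> Z \<le> Y \<and> h Z = 0 \<and> 0 < deriv h Z"
proof -
  have cont: "continuous_on A h" for A
    by (meson DERIV_isCont continuous_at_imp_continuous_on diff)
  from DERIV_neg_dec_right[OF diff stable(2)] obtain d
    where d: "d > 0" "\<And>k. 0 < k \<Longrightarrow> k < d \<Longrightarrow> h (X + k) < 0" using stable(1) by auto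
  have near: "h z < 0" if "X < z" "z < X + d" for z
    using d(2)[of "z - X"] that by simp
  define K where "K = {X + d/2..Y} \<inter> h -` {0}"
  have "Y \<in> K"
    using near[of Y] above d(1) by (force simp: K_def)
  then have "K \<noteq> {}" by blast
  moreover have "compact K"
    unfolding K_def
    by (intro compact_Int_closed closed_vimage compact_Icc closed_singleton)
       (simp add: cont)
  ultimately obtain Z where Z: "Z \<in> K" and first: "\<And>z. z \<in> K \<Longrightarrow> Z \<le> z"
    using compact_attains_inf[of K] by metis
  have ZK: "X < Z" "Z \<le> Y" "h Z = 0" using Z d(1) by (auto simp: K_def)
  have neg: "h z < 0" if z: "X < z" "z < Z" for z
  proof (rule ccontr)
    assume "\<not> h z < 0"
    define y where "y = min z (X + d/2)"
    have y: "X < y" "y \<le> z" "y < X + d" using z d(1) by (auto simp: y_def)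
    obtain w where w: "y \<le> w" "w \<le> z" "h w = 0"
      using IVT'[of h y 0 z] near[OF y(1,3)] \<open>\<not> h z < 0\<close> y(2) cont by force
    then have "X + d \<le> w" using near[of w] y(1) by force
    then have "w \<in> K" using w z(2) ZK(2) d(1) by (simp add: K_def)
    with first[of w] w(2) z(2) show False by simp
  qed
  have "\<not> deriv h Z < 0"
  proof
    assume "deriv h Z < 0"
    from DERIV_neg_dec_left[OF diff this] obtain e
      where e: "e > 0" "\<And>k. 0 < k \<Longrightarrow> k < e \<Longrightarrow> h Z < h (Z - k)" by blast
    let ?k = "min (e/2) ((Z - X)/2)"
    have "0 < ?k" "?k < e" "X < Z - ?k"
      using e(1) ZK(1) by (auto simp: min_def field_simps)
    with e(2)[of ?k] neg[of "Z - ?k"] ZK(3) show False by simp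
  qed
  with simple[OF ZK(3)] ZK show ?thesis by force
qed


section \<open>Pullback solutions\<close>

lemma sup_dist_less_imp_dist_less:
  assumes "sup_dist x y < ereal c"
  shows "\<bar>x t - y t\<bar> < c"
proof -
  have "ereal \<bar>x t - y t\<bar> \<le> sup_dist x y"
    unfolding sup_dist_def by (rule SUP_upper) simp
  with assms show ?thesis by (metis less_ereal.simps(1) order_le_less_trans)
qed

lemma series_approx_bounded:
  assumes "bounded_formal_series f \<Lambda> X"
  shows "\<exists>B. \<forall>t. \<bar>series_approx f \<Lambda> X n r t\<bar> \<le> B"
proof -
  have "\<forall>i. \<exists>b. \<forall>\<tau>. \<bar>series_coeff f \<Lambda> X i \<tau>\<bar> \<le> b"
    using assms by (auto simp: bounded_formal_series_def bounded_iff)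
  then obtain b where b: "\<And>i \<tau>. \<bar>series_coeff f \<Lambda> X i \<tau>\<bar> \<le> b i" by metis
  have "\<bar>series_approx f \<Lambda> X n r t\<bar> \<le> (\<Sum>i\<le>n. b i * \<bar>r ^ i\<bar>)" for t
    unfolding series_approx_def
    by (rule order_trans[OF sum_abs sum_mono]) (auto simp: abs_mult intro!: mult_right_mono b)
  then show ?thesis by blast
qed

lemma solves_concatenate:
  assumes x: "solves g UNIV x" and y: "solves g UNIV y" and meet: "x s = y s"
  shows "solves g UNIV (\<lambda>t. if t \<le> s then x t else y t)"
proof -
  let ?z = "\<lambda>t. if t \<le> s then x t else y t"
  have "(?z has_real_derivative g t (?z t)) (at t)" for t
  proof -
    have dx: "(x has_real_derivative g t (x t)) (at t)"
      and dy: "(y has_real_derivative g t (y t)) (at t)"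
      using x y by (auto simp: solves_def)
    consider "t < s" | "s < t" | "t = s" by linarith
    then show ?thesis
    proof cases
      case 1
      then show ?thesis
        using has_field_derivative_transform_within_open[OF dx open_lessThan[of s], of ?z] by simp
    next
      case 2
      then show ?thesis
        using has_field_derivative_transform_within_open[OF dy open_greaterThan[of s], of ?z]
        by simp
    next
      case 3
      (* At the joint the two one-sided derivatives agree, because both solutions take the same
         value there. *)
      have "(?z has_real_derivative g s (x s)) (at s within {..s})"
        by (rule has_field_derivative_transform_within[of x _ _ _ 1])
           (use dx 3 in \<open>auto intro: has_field_derivative_at_within\<close>)
      moreover have "(?z has_real_derivative g s (x s)) (at s within {s..})"
        by (rule has_field_derivative_transform_within[of y _ _ _ 1])
           (use dy 3 meet in \<open>auto intro: has_field_derivative_at_within\<close>)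
      ultimately have "(?z has_real_derivative g s (x s)) (at s within {..s} \<union> {s..})"
        by (simp add: has_field_derivative_iff Lim_within_Un)
      moreover have "{..s} \<union> {s..} = UNIV" by auto
      ultimately show ?thesis using 3 by simp
    qed
  qed
  then show ?thesis by (simp add: solves_def)
qed

text \<open>
  If they met, following the past solution up to the meeting time and the future solution from
  then on would give a solution with the past limit of the former. Uniqueness in the past
  identifies it with the past solution, which then has the future limit of the other one;
  uniqueness in the future makes the two equal.
\<close>

lemma pullback_solutions_never_meet:
  assumes past: "unique_past_solution f \<Lambda> r X \<infinity> x"
    and future: "unique_future_solution f \<Lambda> r Z (- \<infinity>) y"
    and distinct: "x \<noteq> y"
  shows "x s \<noteq> y s"
proof
  assume meet: "x s = y s"
  let ?g = "\<lambda>t z. f z (\<Lambda> (r * t))"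
  let ?z = "\<lambda>t. if t \<le> s then x t else y t"
  have x: "solves ?g UNIV x" "(x \<longlongrightarrow> X) at_bot" and y: "solves ?g UNIV y" "(y \<longlongrightarrow> Z) at_top"
    using past future
    by (auto simp: unique_past_solution_def past_solution_def
        unique_future_solution_def future_solution_def)
  have "(?z \<longlongrightarrow> X) at_bot"
    by (rule Lim_transform_eventually[OF x(2)])
       (auto simp: eventually_at_bot_linorder)
  then have "past_solution f \<Lambda> r X \<infinity> ?z"
    using solves_concatenate[OF x(1) y(1) meet] by (simp add: past_solution_def)
  with past have "?z t = x t" for t
    by (simp add: unique_past_solution_def)
  then have eq: "x t = y t" if "s < t" for t
    using that by (metis linorder_not_le)
  have "(x \<longlongrightarrow> Z) at_top"
    by (rule Lim_transform_eventually[OF y(2)])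
       (simp add: eq eventually_at_top_dense exI[of _ s])
  then have "future_solution f \<Lambda> r Z (- \<infinity>) x"
    using x(1) by (simp add: future_solution_def)
  with future have "x t = y t" for t
    by (simp add: unique_future_solution_def)
  with distinct show False by blast
qed

lemma continuous_order_persists:
  fixes x y :: "real \<Rightarrow> real"
  assumes "continuous_on UNIV x" "continuous_on UNIV y"
    and never_meet: "\<And>s. x s \<noteq> y s" and "y t0 < x t0" "t0 \<le> t"
  shows "y t < x t"
proof (rule ccontr)
  assume "\<not> y t < x t"
  moreover have "continuous_on {t0..t} (\<lambda>s. x s - y s)"
    using assms(1,2) by (intro continuous_intros) (auto intro: continuous_on_subset)
  ultimately obtain s where "x s - y s = 0"
    using IVT2'[of "\<lambda>s. x s - y s" t 0 t0] assms(4,5) by force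
  with never_meet[of s] show False by simp
qed


section \<open>Criterion for end-point tracking\<close>

theorem proposition4p4:
  fixes f :: "real \<Rightarrow> real \<Rightarrow> real"
    and lm lp :: real
    and \<Lambda> Xs Xu :: "real \<Rightarrow> real"
    and xm xp :: "real \<Rightarrow> real \<Rightarrow> real"
    and \<beta>m \<beta>p :: "real \<Rightarrow> ereal"
    and Cs Cu rs ru :: "nat \<Rightarrow> real"
    and n :: nat
    and r \<epsilon> T :: real
  assumes H0_H1: "setting_H1 f lm lp \<Lambda> Xs Xu"
    and smooth: "x_smooth f"
    and bounded_along_Xs: "\<forall>j. bounded (range (\<lambda>\<tau>. partial_x j f (Xs (\<Lambda> \<tau>)) (\<Lambda> \<tau>)))"
    and bounded_along_Xu: "\<forall>j. bounded (range (\<lambda>\<tau>. partial_x j f (Xu (\<Lambda> \<tau>)) (\<Lambda> \<tau>)))"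
    and xm: "\<forall>\<rho>>0. unique_past_solution f \<Lambda> \<rho> (Xs lm) (\<beta>m \<rho>) (xm \<rho>)"
    and xp: "\<forall>\<rho>>0. unique_future_solution f \<Lambda> \<rho> (Xu lp) (\<beta>p \<rho>) (xp \<rho>)"
    and series_s: "bounded_formal_series f \<Lambda> Xs"
    and series_u: "bounded_formal_series f \<Lambda> Xu"
    and constants_pos: "\<forall>m. Cs m > 0 \<and> Cu m > 0 \<and> rs m > 0 \<and> ru m > 0"
    and estimate_s: "\<forall>m \<rho>. 0 < \<rho> \<and> \<rho> < rs m \<longrightarrow>
          \<beta>m \<rho> = \<infinity> \<and>
          sup_dist (series_approx f \<Lambda> Xs m \<rho>) (xm \<rho>) < ereal (Cs m * \<rho> ^ (m + 1))"
    and estimate_u: "\<forall>m \<rho>. 0 < \<rho> \<and> \<rho> < ru m \<longrightarrow>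
          \<beta>p \<rho> = - \<infinity> \<and>
          sup_dist (series_approx f \<Lambda> Xu m \<rho>) (xp \<rho>) < ereal (Cu m * \<rho> ^ (m + 1))"
    and r: "0 < r" "r < min (rs n) (ru n)"
    and eps_T: "\<epsilon> > 0" "T > 0"
    and separation: "\<forall>t>T.
          Xu lp + \<epsilon> < series_approx f \<Lambda> Xs n r t - Cs n * r ^ (n + 1) \<or>
          series_approx f \<Lambda> Xu n r (- t) + Cu n * r ^ (n + 1) < Xs lm - \<epsilon>"
  shows "xm r \<noteq> xp r \<and>
    ((\<forall>Y. unstable_hyperbolic f lp Y \<longrightarrow> Y = Xu lp) \<or>
     (\<forall>Y. unstable_hyperbolic f lp Y \<and> Y \<noteq> Xu lp \<and> Y > Xs lp \<longrightarrow>
        (\<forall>t>T. series_approx f \<Lambda> Xs n r t + Cs n * r ^ (n + 1) < Y - \<epsilon>))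
     \<longrightarrow> end_point_tracks (\<beta>m r) (xm r) (Xs lp))"
proof -
  interpret setting_H1 f lm lp \<Lambda> Xs Xu by (rule H0_H1)
  let ?Ss = "series_approx f \<Lambda> Xs n r" and ?Su = "series_approx f \<Lambda> Xu n r"
  let ?es = "Cs n * r ^ (n + 1)" and ?eu = "Cu n * r ^ (n + 1)"
  define x where "x = xm r"
  define y where "y = xp r"
  have ends: "\<beta>m r = \<infinity>" "\<beta>p r = - \<infinity>" using estimate_s estimate_u r by auto
  have past: "unique_past_solution f \<Lambda> r (Xs lm) \<infinity> x"
    and future: "unique_future_solution f \<Lambda> r (Xu lp) (- \<infinity>) y"
    using xm[rule_format, OF r(1)] xp[rule_format, OF r(1)] by (simp_all add: ends x_def y_def)
  have near_s: "\<bar>?Ss t - x t\<bar> < ?es" and near_u: "\<bar>?Su t - y t\<bar> < ?eu" for t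
    using estimate_s estimate_u r sup_dist_less_imp_dist_less unfolding x_def y_def
    by (meson min_less_iff_conj)+
  have x_lim: "(x \<longlongrightarrow> Xs lm) at_bot" and y_lim: "(y \<longlongrightarrow> Xu lp) at_top"
    and dx: "\<And>t. (x has_real_derivative f (x t) (\<Lambda> (r * t))) (at t)"
    and dy: "\<And>t. (y has_real_derivative f (y t) (\<Lambda> (r * t))) (at t)"
    using past future
    by (auto simp: unique_past_solution_def past_solution_def
        unique_future_solution_def future_solution_def solves_def)
  have cont_x: "continuous_on UNIV x" and cont_y: "continuous_on UNIV y"
    by (meson DERIV_isCont continuous_at_imp_continuous_on dx dy)+
  have lp: "lp \<in> {lm..lp}" using lm_less_lp by simp
  have separated: "Xu lp + \<epsilon> < x t \<or> y (- t) < Xs lm - \<epsilon>" if "T < t" for t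
    using separation that near_s[of t] near_u[of "- t"] by force
  have "\<forall>\<^sub>F t in at_bot. Xs lm - \<epsilon> < x t"
    using order_tendstoD(1)[OF x_lim] eps_T(1) by simp
  then obtain b where b: "\<And>t. t \<le> b \<Longrightarrow> Xs lm - \<epsilon> < x t"
    by (auto simp: eventually_at_bot_linorder)
  have x_past: "Xs lm - \<epsilon> < x (- t)" if "- b \<le> t" for t
    using b[of "- t"] that by simp

  have distinct: "x \<noteq> y"
  proof
    assume eq: "x = y"
    have "\<forall>\<^sub>F t in at_top. y t < Xu lp + \<epsilon>"
      using order_tendstoD(2)[OF y_lim] eps_T(1) by simp
    then obtain t2 where t2: "\<And>t. t2 \<le> t \<Longrightarrow> y t < Xu lp + \<epsilon>"
      by (auto simp: eventually_at_top_linorder)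
    let ?t = "max (T + 1) (max (- b) t2)"
    have "T < ?t" "- b \<le> ?t" "t2 \<le> ?t" by auto
    from separated[OF this(1)] x_past[OF this(2)] t2[OF this(3)] eq show False by auto
  qed

  have f_eq: "partial_x 0 f = f" by (simp add: fun_eq_iff partial_x_def)
  have cont_f: "continuous_on UNIV (\<lambda>(y, m). f y m)"
    and diff_f: "\<And>z. ((\<lambda>z. f z lp) has_real_derivative deriv (\<lambda>z. f z lp) z) (at z)"
    using smooth[unfolded x_smooth_def, rule_format, of 0] f_eq
    by (simp_all add: DERIV_deriv_iff_field_differentiable)
  have simple: "deriv (\<lambda>z. f z lp) z \<noteq> 0" if "f z lp = 0" for z
  proof -
    obtain E where "E \<subseteq> {lm<..<lp}"
      and E: "\<forall>\<mu>\<in>{lm..lp} - E. \<forall>X. fixed_point f \<mu> X \<longrightarrow> hyperbolic f \<mu> X"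
      using finite_nonhyperbolic by blast
    then have "lp \<in> {lm..lp} - E" using lp by auto
    with E that show ?thesis by (auto simp: fixed_point_def hyperbolic_def partial_x_def)
  qed
  have stable: "f (Xs lp) lp = 0" "deriv (\<lambda>z. f z lp) (Xs lp) < 0"
    using Xs_stable lp
    by (auto simp: stable_hyperbolic_def hyperbolic_def fixed_point_def partial_x_def)
  have "filterlim (\<lambda>t. r * t) at_top at_top"
    by (rule filterlim_tendsto_pos_mult_at_top[OF tendsto_const r(1) filterlim_ident])
  then have parameter: "((\<lambda>t. \<Lambda> (r * t)) \<longlongrightarrow> lp) at_top"
    by (rule filterlim_compose[OF Lambda_at_top])
  obtain B where B: "\<And>t. \<bar>?Ss t\<bar> \<le> B" using series_approx_bounded[OF series_s] by blast
  have bounded: "\<bar>x t\<bar> \<le> B + ?es" for t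
    using near_s[of t] B[of t] by linarith
  obtain Y where Y: "(x \<longlongrightarrow> Y) at_top"
    using bounded_asymptotically_autonomous_converges[OF cont_f parameter dx bounded
        nonzero_between_if_simple_zeros[OF simple]] by blast
  have Y_zero: "f Y lp = 0"
    by (rule asymptotically_autonomous_limit_is_zero[OF cont_f parameter dx Y])

  have "Y \<noteq> Xu lp"
  proof
    assume "Y = Xu lp"
    with Y dx have "future_solution f \<Lambda> r (Xu lp) (- \<infinity>) x"
      by (simp add: future_solution_def solves_def)
    with future have "x t = y t" for t by (simp add: unique_future_solution_def)
    with distinct show False by blast
  qed
  moreover have "Xu lp \<le> Y"
  proof (cases "\<forall>\<^sub>F t in at_top. Xu lp + \<epsilon> < x t")
    case True
    then have "\<forall>\<^sub>F t in at_top. Xu lp \<le> x t"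
      using eps_T(1) by (auto elim: eventually_mono)
    then show ?thesis by (rule tendsto_lowerbound[OF Y]) simp
  next
    case False
    then obtain t where t: "max (T + 1) (- b) \<le> t" "\<not> Xu lp + \<epsilon> < x t"
      unfolding eventually_at_top_linorder by blast
    then have "y (- t) < x (- t)" using separated[of t] x_past[of t] by simp
    then have "y u < x u" if "- t \<le> u" for u
      using continuous_order_persists[OF cont_x cont_y
          pullback_solutions_never_meet[OF past future distinct]] that by blast
    then have "\<forall>\<^sub>F u in at_top. y u \<le> x u"
      by (auto simp: eventually_at_top_linorder intro: less_imp_le)
    then show ?thesis by (rule tendsto_le[OF _ Y y_lim, rotated]) simp
  qed
  ultimately have "Xu lp < Y" by simp
  then have "Xs lp \<le> Y"
    using none_between lp Y_zero Xu_less_Xs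
    by (force simp: fixed_point_def open_segment_eq_real_ivl)

  have "Y = Xs lp"
    if no_escape: "(\<forall>Y. unstable_hyperbolic f lp Y \<longrightarrow> Y = Xu lp) \<or>
     (\<forall>Y. unstable_hyperbolic f lp Y \<and> Y \<noteq> Xu lp \<and> Y > Xs lp \<longrightarrow> (\<forall>t>T. ?Ss t + ?es < Y - \<epsilon>))"
  proof (rule ccontr)
    assume "Y \<noteq> Xs lp"
    with \<open>Xs lp \<le> Y\<close> have "Xs lp < Y" by simp
    with unstable_zero_above_stable_zero[OF diff_f simple stable Y_zero]
    obtain Z where Z: "Xs lp < Z" "Z \<le> Y" "f Z lp = 0" "0 < deriv (\<lambda>z. f z lp) Z" by blast
    then have "unstable_hyperbolic f lp Z"
      by (simp add: unstable_hyperbolic_def hyperbolic_def fixed_point_def partial_x_def)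
    moreover have "Z \<noteq> Xu lp" using Xu_less_Xs lp Z(1) by force
    ultimately have "\<forall>t>T. ?Ss t + ?es < Z - \<epsilon>" using no_escape Z(1) by blast
    then have "x t \<le> Z - \<epsilon>" if "T < t" for t
      using that near_s[of t] by force
    then have "\<forall>\<^sub>F t in at_top. x t \<le> Z - \<epsilon>" by (auto simp: eventually_at_top_dense)
    then have "Y \<le> Z - \<epsilon>" by (rule tendsto_upperbound[OF Y]) simp
    with Z(2) eps_T(1) show False by simp
  qed
  with Y distinct ends(1) show ?thesis
    unfolding end_point_tracks_def x_def y_def by blast
qed

end
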